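(* Let $\Pi$ be a finite set of proposition symbols and $\Delta\in\mathbb{N}$. Given a $\Pi$-program of $\mathrm{MPMSC}$ of size $m$, one can construct a message passing circuit (MPC) for $(\Pi,\Delta)$ of size $\mathcal{O}(\Delta m+|\Pi|)$ that is strongly equivalent to the program.
   Context: Proposition symbols: a countably infinite, linearly ordered set partitioned into ordinary and identifier symbols; for finite $\Pi$, $\Pi_1$ denotes its identifier symbols. A Kripke model over $\Pi$ is $M=(W,R,V)$, $W\ne\emptyset$, $R\subseteq W\times W$, $V:\Pi\to\mathcal P(W)$. With $p_1,\dots,p_\ell$ listing $\Pi_1$ in order, $\mathrm{ID}(w)$ is the $\ell$-bit string whose $i$th bit is $1$ iff $w\in V(p_i)$; $M$ has identifiers if $\mathrm{ID}$ is injective. The local input of $w$ is the $|\Pi|$-bit string recording which symbols of $\Pi$ (in order) hold at $w$. $\mathcal K(\Pi,\Delta)$: finite Kripke models over $\Pi$ with identifiers and out-degree at most $\Delta$. If the successors of $w$ have identifiers $s_1<\dots<s_d$ lexicographically, the one with identifier $s_i$ is the $i$th neighbour of $w$. Sequences: for a sequence $(\overline b_n)_n$ of $k$-bit strings and $A,P\subseteq[k]$, the appointed string of round $n$ is the substring of $\overline b_n$ at positions $A\cup P$. Circuits: a Boolean circuit is a DAG with gates labelled $\wedge,\vee$ (any fan-in) or $\neg$ (fan-in 1) except input gates; inputs and outputs are linearly ordered; size = number of gates. An MPC for $(\Pi,\Delta)$ is a circuit computing $\{0,1\}^{|\Pi|+k(\Delta+1)}\to\{0,1\}^k$ with attention and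 print bit sets $A,P\subseteq[k]$. On $M\in\mathcal K(\Pi,\Delta)$: $f_0(w)=C(\overline t_w\cdot0^{k(\Delta+1)})$ with $\overline t_w$ the local input, $f_{n+1}(w)=C(\overline t_w\cdot f_n(w)\cdot f_n(v_1)\cdots f_n(v_m)\cdot(0^k)^{\Delta-m})$, $v_1,\dots,v_m$ the neighbours of $w$ in order. Its appointed string at $w$ in round $n$ is that of $(f_n(w))_n$ w.r.t. $(k,A,P)$. MPMSC: schemata are built by $\varphi::=\top\mid p\mid X\mid\neg\varphi\mid(\varphi\wedge\varphi)\mid\Diamond_i\varphi$ ($p\in\Pi$, $X$ a schema variable, $i\in\mathbb Z_+$), where $\Diamond_i\varphi$ holds at $w$ iff $w$ has an $i$th neighbour and $\varphi$ holds there. A $\Pi$-program of MPMSC has distinct head predicates $Y_1,\dots,Y_k$ (fixed order), a terminal clause $Y_i(0):=\varphi_i$ for each $i$ with $\varphi_i$ diamond- and variable-free, and for each $i$ an iteration clause, either standard $Y_i:=\psi$ or conditional $Y_i:=_{\varphi_1,\dots,\varphi_n}\psi_1;\dots;\psi_n;\chi$, where conditions have modal depth $0$ and $\psi,\psi_j,\chi$ have modal depth at most $1$ (schemata over $\{Y_1,\dots,Y_k\}$); plus sets of attention and print predicates among the heads. Semantics: $Y_i^0=\varphi_i$; for a standard clause $Y_i^{n+1}=\psi^{n+1}$; for a conditional clause $Y_i^{n+1}=\bigvee_{j\le n}\big(\bigwedge_{j'<j}\neg\varphi_{j'}^{n+1}\wedge\varphi_j^{n+1}\wedge\psi_j^{n+1}\big)\vee\big(\bigwedge_{j\le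 n}\neg\varphi_j^{n+1}\wedge\chi^{n+1}\big)$, where $\theta^{n+1}$ is $\theta$ with each $Y_j$ replaced by $Y_j^n$. The round-$n$ configuration at $w$ is the $k$-bit string with $i$th bit $1$ iff $(M,w)\models Y_i^n$, and the appointed string of round $n$ is its restriction to positions of attention/print predicates. Size = number of occurrences of proposition symbols, head predicates, $\top,\neg,\wedge,\Diamond_i$. Strong equivalence: a program and an MPC for $(\Pi,\Delta)$ are strongly equivalent if for every $M\in\mathcal K(\Pi,\Delta)$ interpreting all symbols of the program, every node $w$ and every round $n$, they produce the same appointed string at $w$ in round $n$.
   Formalization: The size bound is stated with max(1,Δ) in place of Δ, since for Δ=0 and empty Π the bound O(Δm+|Π|) would be 0 although an output gate is needed; models have nodes in one fixed type, which for the natural numbers covers all finite models up to isomorphism. *)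

theory Defs
  imports Complex_Main "HOL-Library.List_Lexorder" "HOL-Library.Countable"
    "HOL-Library.Infinite_Typeclass"
begin

section \<open>Kripke models with identifiers\<close>

text \<open>
  Proposition symbols are the elements of a linearly ordered type; the parameter \<open>Ids\<close> is the set of
  identifier symbols (all others are ordinary), and \<open>PS\<close> is the finite set of symbols in use.
  Bit strings are Boolean lists with \<open>False\<close> for 0. Positions are counted from 0.
\<close>

record ('w, 'p) kripke =
  worlds :: "'w set"
  accs :: "('w \<times> 'w) set"
  valuation :: "'p \<Rightarrow> 'w set"

definition ident :: "'p::linorder set \<Rightarrow> 'p set \<Rightarrow> ('w, 'p) kripke \<Rightarrow> 'w \<Rightarrow> bool list" where
  "ident Ids PS M w = map (\<lambda>p. w \<in> valuation M p) (sorted_list_of_set (PS \<inter> Ids))"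

definition local_input :: "'p::linorder set \<Rightarrow> ('w, 'p) kripke \<Rightarrow> 'w \<Rightarrow> bool list" where
  "local_input PS M w = map (\<lambda>p. w \<in> valuation M p) (sorted_list_of_set PS)"

definition id_models ::
    "'p::linorder set \<Rightarrow> 'p set \<Rightarrow> nat \<Rightarrow> ('w, 'p) kripke set" where
  "id_models Ids PS \<Delta> = {M.
     finite (worlds M) \<and> worlds M \<noteq> {} \<and>
     accs M \<subseteq> worlds M \<times> worlds M \<and>
     (\<forall>p\<in>PS. valuation M p \<subseteq> worlds M) \<and>
     inj_on (ident Ids PS M) (worlds M) \<and>
     (\<forall>w\<in>worlds M. card (accs M `` {w}) \<le> \<Delta>)}"

text \<open>
  The successors of a node, sorted by identifier; the order on Boolean lists is the lexicographic
  one of \<^theory>\<open>HOL-Library.List_Lexorder\<close>. The \<open>i\<close>th neighbour is the element at index \<open>i - 1\<close>.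
\<close>

definition neighbours ::
    "'p::linorder set \<Rightarrow> 'p set \<Rightarrow> ('w, 'p) kripke \<Rightarrow> 'w \<Rightarrow> 'w list" where
  "neighbours Ids PS M w = sorted_key_list_of_set (ident Ids PS M) (accs M `` {w})"

definition appointed :: "nat set \<Rightarrow> nat set \<Rightarrow> bool list \<Rightarrow> bool list" where
  "appointed A P b = nths b (A \<union> P)"


section \<open>Boolean circuits\<close>

datatype gate_kind = Input_gate | And_gate | Or_gate | Not_gate

text \<open>A wire \<open>(g, h)\<close> makes the output of gate \<open>g\<close> an argument of gate \<open>h\<close>.\<close>

record circuit =
  gates :: "nat set"
  wires :: "(nat \<times> nat) set"
  kind :: "nat \<Rightarrow> gate_kind"
  in_gates :: "nat list"
  out_gates :: "nat list"

definition boolean_circuit :: "circuit \<Rightarrow> bool" where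
  "boolean_circuit C \<longleftrightarrow>
     finite (gates C) \<and> wires C \<subseteq> gates C \<times> gates C \<and> acyclic (wires C) \<and>
     distinct (in_gates C) \<and> set (in_gates C) = {g \<in> gates C. kind C g = Input_gate} \<and>
     distinct (out_gates C) \<and> set (out_gates C) \<subseteq> gates C \<and>
     (\<forall>g\<in>gates C. kind C g = Input_gate \<longrightarrow> {h. (h, g) \<in> wires C} = {}) \<and>
     (\<forall>g\<in>gates C. kind C g = Not_gate \<longrightarrow> card {h. (h, g) \<in> wires C} = 1)"

definition circuit_size :: "circuit \<Rightarrow> nat" where
  "circuit_size C = card (gates C)"

definition gate_step :: "circuit \<Rightarrow> bool list \<Rightarrow> (nat \<Rightarrow> bool) \<Rightarrow> nat \<Rightarrow> bool" where
  "gate_step C x v g = (case kind C g of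
       Input_gate \<Rightarrow> the (map_of (zip (in_gates C) x) g)
     | And_gate \<Rightarrow> (\<forall>h. (h, g) \<in> wires C \<longrightarrow> v h)
     | Or_gate \<Rightarrow> (\<exists>h. (h, g) \<in> wires C \<and> v h)
     | Not_gate \<Rightarrow> (\<exists>h. (h, g) \<in> wires C \<and> \<not> v h))"

text \<open>
  Gate values by recursion along the wires, which form a well-founded relation in every Boolean
  circuit; the recursion equation is \<open>gate_value_eq\<close> below.
\<close>

definition gate_value :: "circuit \<Rightarrow> bool list \<Rightarrow> nat \<Rightarrow> bool" where
  "gate_value C x = wfrec (wires C) (gate_step C x)"

lemma gate_value_eq:
  assumes "boolean_circuit C"
  shows "gate_value C x g = gate_step C x (gate_value C x) g"
proof -
  have "finite (wires C)"
    using assms by (auto simp: boolean_circuit_def intro: finite_subset)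
  then have wf: "wf (wires C)"
    using assms by (simp add: boolean_circuit_def finite_acyclic_wf)
  have "gate_value C x g = gate_step C x (cut (gate_value C x) (wires C) g) g"
    unfolding gate_value_def by (rule wfrec[OF wf])
  also have "\<dots> = gate_step C x (gate_value C x) g"
    by (auto simp: gate_step_def cut_def split: gate_kind.split)
  finally show ?thesis .
qed

definition circuit_output :: "circuit \<Rightarrow> bool list \<Rightarrow> bool list" where
  "circuit_output C x = map (gate_value C x) (out_gates C)"


section \<open>Message passing circuits\<close>

record mpc =
  circ :: circuit
  att_bits :: "nat set"
  print_bits :: "nat set"

definition mpc_width :: "mpc \<Rightarrow> nat" where
  "mpc_width N = length (out_gates (circ N))"

definition mpc_for :: "'p set \<Rightarrow> nat \<Rightarrow> mpc \<Rightarrow> bool" where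
  "mpc_for PS \<Delta> N \<longleftrightarrow>
     boolean_circuit (circ N) \<and>
     length (in_gates (circ N)) = card PS + mpc_width N * (\<Delta> + 1) \<and>
     att_bits N \<subseteq> {..<mpc_width N} \<and> print_bits N \<subseteq> {..<mpc_width N}"

definition mpc_size :: "mpc \<Rightarrow> nat" where
  "mpc_size N = circuit_size (circ N)"

fun mpc_state ::
    "'p::linorder set \<Rightarrow> 'p set \<Rightarrow> nat \<Rightarrow> mpc \<Rightarrow> ('w, 'p) kripke \<Rightarrow> nat \<Rightarrow> 'w \<Rightarrow> bool list" where
  "mpc_state Ids PS \<Delta> N M 0 w =
     circuit_output (circ N) (local_input PS M w @ replicate (mpc_width N * (\<Delta> + 1)) False)"
| "mpc_state Ids PS \<Delta> N M (Suc n) w =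
     (let vs = neighbours Ids PS M w in
      circuit_output (circ N)
        (local_input PS M w @ mpc_state Ids PS \<Delta> N M n w
         @ concat (map (mpc_state Ids PS \<Delta> N M n) vs)
         @ concat (replicate (\<Delta> - length vs) (replicate (mpc_width N) False))))"

definition mpc_appointed ::
    "'p::linorder set \<Rightarrow> 'p set \<Rightarrow> nat \<Rightarrow> mpc \<Rightarrow> ('w, 'p) kripke \<Rightarrow> nat \<Rightarrow> 'w \<Rightarrow> bool list" where
  "mpc_appointed Ids PS \<Delta> N M n w =
     appointed (att_bits N) (print_bits N) (mpc_state Ids PS \<Delta> N M n w)"


section \<open>Programs of MPMSC\<close>

datatype ('p, 'v) schema =
    Top
  | Prop 'p
  | SVar 'v
  | Neg "('p, 'v) schema"
  | Conj "('p, 'v) schema" "('p, 'v) schema"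
  | Dia nat "('p, 'v) schema"

text \<open>Diamond indices are positive.\<close>

fun schema_over :: "'p set \<Rightarrow> 'v set \<Rightarrow> ('p, 'v) schema \<Rightarrow> bool" where
  "schema_over PS T Top \<longleftrightarrow> True"
| "schema_over PS T (Prop p) \<longleftrightarrow> p \<in> PS"
| "schema_over PS T (SVar Y) \<longleftrightarrow> Y \<in> T"
| "schema_over PS T (Neg \<phi>) \<longleftrightarrow> schema_over PS T \<phi>"
| "schema_over PS T (Conj \<phi> \<psi>) \<longleftrightarrow> schema_over PS T \<phi> \<and> schema_over PS T \<psi>"
| "schema_over PS T (Dia i \<phi>) \<longleftrightarrow> i \<ge> 1 \<and> schema_over PS T \<phi>"

fun modal_depth :: "('p, 'v) schema \<Rightarrow> nat" where
  "modal_depth Top = 0"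
| "modal_depth (Prop p) = 0"
| "modal_depth (SVar Y) = 0"
| "modal_depth (Neg \<phi>) = modal_depth \<phi>"
| "modal_depth (Conj \<phi> \<psi>) = max (modal_depth \<phi>) (modal_depth \<psi>)"
| "modal_depth (Dia i \<phi>) = Suc (modal_depth \<phi>)"

fun schema_size :: "('p, 'v) schema \<Rightarrow> nat" where
  "schema_size Top = 1"
| "schema_size (Prop p) = 1"
| "schema_size (SVar Y) = 1"
| "schema_size (Neg \<phi>) = Suc (schema_size \<phi>)"
| "schema_size (Conj \<phi> \<psi>) = Suc (schema_size \<phi> + schema_size \<psi>)"
| "schema_size (Dia i \<phi>) = Suc (schema_size \<phi>)"

fun schema_subst :: "('v \<Rightarrow> ('p, 'v) schema) \<Rightarrow> ('p, 'v) schema \<Rightarrow> ('p, 'v) schema" where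
  "schema_subst \<sigma> Top = Top"
| "schema_subst \<sigma> (Prop p) = Prop p"
| "schema_subst \<sigma> (SVar Y) = \<sigma> Y"
| "schema_subst \<sigma> (Neg \<phi>) = Neg (schema_subst \<sigma> \<phi>)"
| "schema_subst \<sigma> (Conj \<phi> \<psi>) = Conj (schema_subst \<sigma> \<phi>) (schema_subst \<sigma> \<psi>)"
| "schema_subst \<sigma> (Dia i \<phi>) = Dia i (schema_subst \<sigma> \<phi>)"

definition Disj :: "('p, 'v) schema \<Rightarrow> ('p, 'v) schema \<Rightarrow> ('p, 'v) schema" where
  "Disj \<phi> \<psi> = Neg (Conj (Neg \<phi>) (Neg \<psi>))"

definition big_conj :: "('p, 'v) schema list \<Rightarrow> ('p, 'v) schema" where
  "big_conj \<phi>s = foldr Conj \<phi>s Top"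

definition big_disj :: "('p, 'v) schema list \<Rightarrow> ('p, 'v) schema" where
  "big_disj \<phi>s = foldr Disj \<phi>s (Neg Top)"

text \<open>
  Truth is evaluated only for variable-free schemata (the formulas \<open>unfolding_at\<close> below);
  the value at a schema variable is a dummy.
\<close>

fun sat ::
    "'p::linorder set \<Rightarrow> 'p set \<Rightarrow> ('w, 'p) kripke \<Rightarrow> 'w \<Rightarrow> ('p, 'v) schema \<Rightarrow> bool" where
  "sat Ids PS M w Top \<longleftrightarrow> True"
| "sat Ids PS M w (Prop p) \<longleftrightarrow> w \<in> valuation M p"
| "sat Ids PS M w (SVar Y) \<longleftrightarrow> False"
| "sat Ids PS M w (Neg \<phi>) \<longleftrightarrow> \<not> sat Ids PS M w \<phi>"
| "sat Ids PS M w (Conj \<phi> \<psi>) \<longleftrightarrow> sat Ids PS M w \<phi> \<and> sat Ids PS M w \<psi>"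
| "sat Ids PS M w (Dia i \<phi>) \<longleftrightarrow>
     1 \<le> i \<and> i \<le> length (neighbours Ids PS M w) \<and>
     sat Ids PS M (neighbours Ids PS M w ! (i - 1)) \<phi>"

text \<open>
  A conditional clause lists the pairs of a condition and its consequence, followed by the
  default \<open>\<chi>\<close>.
\<close>

datatype ('p, 'v) iter_clause =
    Standard "('p, 'v) schema"
  | Conditional "(('p, 'v) schema \<times> ('p, 'v) schema) list" "('p, 'v) schema"

text \<open>The clauses of a program are only relevant at its head predicates.\<close>

record ('p, 'v) program =
  heads :: "'v list"
  terminal :: "'v \<Rightarrow> ('p, 'v) schema"
  iteration :: "'v \<Rightarrow> ('p, 'v) iter_clause"
  att_preds :: "'v set"
  print_preds :: "'v set"

fun iter_clause_over :: "'p set \<Rightarrow> 'v set \<Rightarrow> ('p, 'v) iter_clause \<Rightarrow> bool" where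
  "iter_clause_over PS T (Standard \<psi>) \<longleftrightarrow> schema_over PS T \<psi> \<and> modal_depth \<psi> \<le> 1"
| "iter_clause_over PS T (Conditional cs \<chi>) \<longleftrightarrow>
     (\<forall>(\<phi>, \<psi>)\<in>set cs. schema_over PS T \<phi> \<and> modal_depth \<phi> = 0 \<and>
                       schema_over PS T \<psi> \<and> modal_depth \<psi> \<le> 1) \<and>
     schema_over PS T \<chi> \<and> modal_depth \<chi> \<le> 1"

definition mpmsc_program :: "'p set \<Rightarrow> ('p, 'v) program \<Rightarrow> bool" where
  "mpmsc_program PS \<Lambda> \<longleftrightarrow>
     distinct (heads \<Lambda>) \<and>
     (\<forall>Y\<in>set (heads \<Lambda>). schema_over PS {} (terminal \<Lambda> Y) \<and> modal_depth (terminal \<Lambda> Y) = 0) \<and>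
     (\<forall>Y\<in>set (heads \<Lambda>). iter_clause_over PS (set (heads \<Lambda>)) (iteration \<Lambda> Y)) \<and>
     att_preds \<Lambda> \<subseteq> set (heads \<Lambda>) \<and> print_preds \<Lambda> \<subseteq> set (heads \<Lambda>)"

fun iter_clause_size :: "('p, 'v) iter_clause \<Rightarrow> nat" where
  "iter_clause_size (Standard \<psi>) = schema_size \<psi>"
| "iter_clause_size (Conditional cs \<chi>) =
     (\<Sum>(\<phi>, \<psi>)\<leftarrow>cs. schema_size \<phi> + schema_size \<psi>) + schema_size \<chi>"

text \<open>
  The two summands 1 are the occurrences of \<open>Y\<close> on the left-hand sides of its terminal and
  iteration clauses.
\<close>

definition program_size :: "('p, 'v) program \<Rightarrow> nat" where
  "program_size \<Lambda> =
     (\<Sum>Y\<leftarrow>heads \<Lambda>. (1 + schema_size (terminal \<Lambda> Y)) + (1 + iter_clause_size (iteration \<Lambda> Y)))"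

text \<open>The schema whose instance at the previous round is the truth condition of a clause.\<close>

fun iter_schema :: "('p, 'v) iter_clause \<Rightarrow> ('p, 'v) schema" where
  "iter_schema (Standard \<psi>) = \<psi>"
| "iter_schema (Conditional cs \<chi>) =
     Disj
       (big_disj
         (map (\<lambda>j. Conj (big_conj (map (\<lambda>j'. Neg (fst (cs ! j'))) [0..<j]))
                        (Conj (fst (cs ! j)) (snd (cs ! j))))
              [0..<length cs]))
       (Conj (big_conj (map (\<lambda>j. Neg (fst (cs ! j))) [0..<length cs])) \<chi>)"

text \<open>The formula \<open>Y\<^sup>n\<close>:\<close>

fun unfolding_at :: "('p, 'v) program \<Rightarrow> nat \<Rightarrow> 'v \<Rightarrow> ('p, 'v) schema" where
  "unfolding_at \<Lambda> 0 Y = terminal \<Lambda> Y"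
| "unfolding_at \<Lambda> (Suc n) Y = schema_subst (unfolding_at \<Lambda> n) (iter_schema (iteration \<Lambda> Y))"

definition configuration ::
    "'p::linorder set \<Rightarrow> 'p set \<Rightarrow> ('p, 'v) program \<Rightarrow> ('w, 'p) kripke \<Rightarrow> nat \<Rightarrow> 'w \<Rightarrow> bool list" where
  "configuration Ids PS \<Lambda> M n w = map (\<lambda>Y. sat Ids PS M w (unfolding_at \<Lambda> n Y)) (heads \<Lambda>)"

definition head_positions :: "('p, 'v) program \<Rightarrow> 'v set \<Rightarrow> nat set" where
  "head_positions \<Lambda> T = {i. i < length (heads \<Lambda>) \<and> heads \<Lambda> ! i \<in> T}"

definition program_appointed ::
    "'p::linorder set \<Rightarrow> 'p set \<Rightarrow> ('p, 'v) program \<Rightarrow> ('w, 'p) kripke \<Rightarrow> nat \<Rightarrow> 'w \<Rightarrow> bool list" where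
  "program_appointed Ids PS \<Lambda> M n w =
     appointed (head_positions \<Lambda> (att_preds \<Lambda>)) (head_positions \<Lambda> (print_preds \<Lambda>))
       (configuration Ids PS \<Lambda> M n w)"


section \<open>Strong equivalence\<close>

text \<open>
  The type argument only names the type of the nodes of the models quantified over. Models are
  finite, so the type \<^typ>\<open>nat\<close> already covers all of them up to isomorphism.
\<close>

definition strongly_equivalent ::
    "'w itself \<Rightarrow> 'p::linorder set \<Rightarrow> 'p set \<Rightarrow> nat \<Rightarrow> ('p, 'v) program \<Rightarrow> mpc \<Rightarrow> bool" where
  "strongly_equivalent (_ :: 'w itself) Ids PS \<Delta> \<Lambda> N \<longleftrightarrow>
     (\<forall>M :: ('w, 'p) kripke. M \<in> id_models Ids PS \<Delta> \<longrightarrow>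
        (\<forall>w\<in>worlds M. \<forall>n.
           program_appointed Ids PS \<Lambda> M n w = mpc_appointed Ids PS \<Delta> N M n w))"

end

theory Submission
  imports Defs
begin

text \<open>
  The state of the circuit at a node is the configuration of the program, followed by a flag that is
  always 1, followed by the truth values of the proposition symbols occurring in iteration clauses.
  The flag of the node's own block is 0 only in round 0 and thus selects between terminal and
  iteration clauses; the flag of the \<open>i\<close>th neighbour's block is 1 iff that neighbour exists; the
  symbol bits are needed because a node does not see the own_symbol inputs of its neighbours. A
  conditional clause becomes a chain of if-then-else gates, which keeps the size linear although
  the schema defining its meaning is of quadratic size.
\<close>

section \<open>Circuits from formulas\<close>

text \<open>Formulas serve as gates through their code \<open>to_nat\<close>, so equal subformulas
  share one gate. \<open>BTop\<close> becomes a conjunction without arguments and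
  \<open>BBuf\<close> one with a single argument; the index of a buffer has no effect on its value
  and only tells buffers apart.\<close>

datatype bform = BIn nat | BTop | BNot bform | BAnd bform bform | BBuf nat bform

instance bform :: countable
  by countable_datatype

primrec beval :: "bool list \<Rightarrow> bform \<Rightarrow> bool" where
  "beval x (BIn i) = x ! i"
| "beval x BTop = True"
| "beval x (BNot a) = (\<not> beval x a)"
| "beval x (BAnd a b) = (beval x a \<and> beval x b)"
| "beval x (BBuf i a) = beval x a"

primrec inputs :: "bform \<Rightarrow> nat set" where
  "inputs (BIn i) = {i}"
| "inputs BTop = {}"
| "inputs (BNot a) = inputs a"
| "inputs (BAnd a b) = inputs a \<union> inputs b"
| "inputs (BBuf i a) = inputs a"

primrec bsize :: "bform \<Rightarrow> nat" where
  "bsize (BIn i) = 1"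
| "bsize BTop = 1"
| "bsize (BNot a) = Suc (bsize a)"
| "bsize (BAnd a b) = Suc (bsize a + bsize b)"
| "bsize (BBuf i a) = Suc (bsize a)"

primrec children :: "bform \<Rightarrow> bform set" where
  "children (BIn i) = {}"
| "children BTop = {}"
| "children (BNot a) = {a}"
| "children (BAnd a b) = {a, b}"
| "children (BBuf i a) = {a}"

primrec subforms :: "bform \<Rightarrow> bform set" where
  "subforms (BIn i) = {BIn i}"
| "subforms BTop = {BTop}"
| "subforms (BNot a) = insert (BNot a) (subforms a)"
| "subforms (BAnd a b) = insert (BAnd a b) (subforms a \<union> subforms b)"
| "subforms (BBuf i a) = insert (BBuf i a) (subforms a)"

primrec gate_kind_of :: "bform \<Rightarrow> gate_kind" where
  "gate_kind_of (BIn i) = Input_gate"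
| "gate_kind_of BTop = And_gate"
| "gate_kind_of (BNot a) = Not_gate"
| "gate_kind_of (BAnd a b) = And_gate"
| "gate_kind_of (BBuf i a) = And_gate"

section \<open>Subformulas, from which the gates are drawn\<close>

lemma finite_subforms [simp]: "finite (subforms a)"
  by (induction a) auto

lemma self_in_subforms [simp]: "a \<in> subforms a"
  by (cases a) auto

lemma subforms_closed: "b \<in> subforms a \<Longrightarrow> children b \<subseteq> subforms a"
  by (induction a) auto

lemma inputs_subforms: "BIn i \<in> subforms a \<Longrightarrow> i \<in> inputs a"
  by (induction a) auto

lemma card_subforms: "card (subforms a) \<le> bsize a"
proof (induction a)
  case (BAnd a b)
  have "card (subforms (BAnd a b)) \<le> Suc (card (subforms a \<union> subforms b))"
    by (simp add: card_insert_if)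
  also have "\<dots> \<le> Suc (card (subforms a) + card (subforms b))"
    by (simp add: card_Un_le)
  finally show ?case using BAnd by simp
qed (auto simp: card_insert_if le_SucI)

lemma bsize_children: "a \<in> children b \<Longrightarrow> bsize a < bsize b"
  by (cases b) auto

text \<open>
  Since output gates have to be distinct, each formula is topped by a buffer carrying its index.
\<close>

lemma circuit_of_formulas:
  assumes inp: "\<And>a. a \<in> set as \<Longrightarrow> inputs a \<subseteq> {..<n}"
  shows "\<exists>C. boolean_circuit C \<and> length (in_gates C) = n \<and> length (out_gates C) = length as \<and>
             circuit_size C \<le> n + length as + (\<Sum>a\<leftarrow>as. bsize a) \<and>
             (\<forall>x. length x = n \<longrightarrow> circuit_output C x = map (beval x) as)"
proof -
  define B where "B i = BBuf i (as ! i)" for i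
  \<comment> \<open>All \<open>n\<close> inputs are included, even those that no formula reads,
    because the circuit must have exactly \<open>n\<close> input gates.\<close>
  define S where "S = BIn ` {..<n} \<union> (\<Union>i<length as. subforms (B i))"
  define C where "C = \<lparr>gates = to_nat ` S,
      wires = {(to_nat a, to_nat b) | a b. b \<in> S \<and> a \<in> children b},
      kind = (\<lambda>g. gate_kind_of (from_nat g)),
      in_gates = map (\<lambda>i. to_nat (BIn i)) [0..<n],
      out_gates = map (\<lambda>i. to_nat (B i)) [0..<length as]\<rparr>"
  have closed: "children b \<subseteq> S" if "b \<in> S" for b
    using that subforms_closed unfolding S_def by fastforce
  have B_S: "B i \<in> S" if "i < length as" for i
    using that self_in_subforms[of "B i"] unfolding S_def by blast
  have finS: "finite S" by (simp add: S_def)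
  have wires_iff: "(h, to_nat b) \<in> wires C \<longleftrightarrow> b \<in> S \<and> h \<in> to_nat ` children b" for h b
    by (auto simp: C_def)
  have kind_eq: "kind C (to_nat b) = gate_kind_of b" for b
    by (simp add: C_def)
  have input_S: "i < n" if in_S: "BIn i \<in> S" for i
  proof (rule ccontr)
    assume "\<not> i < n"
    then obtain j where "j < length as" "BIn i \<in> subforms (B j)"
      using in_S by (auto simp: S_def)
    then have "i \<in> inputs (as ! j)" by (auto simp: B_def dest: inputs_subforms)
    then show False using inp[of "as ! j"] \<open>j < length as\<close> \<open>\<not> i < n\<close> by auto
  qed
  \<comment> \<open>Formula size strictly grows along every wire, so no cycle can close.\<close>
  have "acyclic (wires C)"
  proof (rule acyclic_subset)
    show "acyclic (inv_image less_than (\<lambda>g. bsize (from_nat g)))"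
      by (simp add: wf_acyclic)
    show "wires C \<subseteq> inv_image less_than (\<lambda>g. bsize (from_nat g))"
      by (auto simp: C_def bsize_children)
  qed
  moreover have "set (in_gates C) = {g \<in> gates C. kind C g = Input_gate}"
  proof -
    have "b \<in> BIn ` {..<n}" if "b \<in> S" "gate_kind_of b = Input_gate" for b
      using that input_S by (cases b) auto
    then have "{b \<in> S. gate_kind_of b = Input_gate} = BIn ` {..<n}"
      by (auto simp: S_def)
    moreover have "{g \<in> gates C. kind C g = Input_gate} =
                   to_nat ` {b \<in> S. gate_kind_of b = Input_gate}"
      by (auto simp: C_def)
    ultimately show ?thesis by (simp add: C_def image_image atLeast0LessThan)
  qed
  moreover have "{h. (h, g) \<in> wires C} = {}" if g: "g \<in> gates C" "kind C g = Input_gate" for g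
  proof -
    have "g \<in> to_nat ` S" using g(1) by (simp add: C_def)
    then obtain b :: bform where b: "g = to_nat b" by blast
    then show ?thesis using g(2) by (cases b) (auto simp: wires_iff kind_eq)
  qed
  moreover have "card {h. (h, g) \<in> wires C} = 1" if g: "g \<in> gates C" "kind C g = Not_gate" for g
  proof -
    have "g \<in> to_nat ` S" using g(1) by (simp add: C_def)
    then obtain b :: bform where b: "g = to_nat b" "b \<in> S" by blast
    then show ?thesis using g(2) by (cases b) (auto simp: wires_iff kind_eq)
  qed
  moreover have "wires C \<subseteq> gates C \<times> gates C"
    using closed by (auto simp: C_def)
  moreover have "finite (gates C)" "distinct (in_gates C)" "distinct (out_gates C)"
    using finS by (simp_all add: C_def distinct_map inj_on_def B_def)
  moreover have "set (out_gates C) \<subseteq> gates C"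
    using B_S by (auto simp: C_def)
  ultimately have bc: "boolean_circuit C"
    unfolding boolean_circuit_def by blast
  \<comment> \<open>The wires into the gate of \<open>b\<close> come exactly from its immediate
    subformulas, so the recursion of the gate values follows that of \<open>beval\<close>.\<close>
  have val: "gate_value C x (to_nat b) = beval x b" if "length x = n" "b \<in> S" for x b
    using that(2)
  proof (induction b)
    case (BIn i)
    then have i: "i < n" by (rule input_S)
    have "map_of (zip (in_gates C) x) (in_gates C ! i) = Some (x ! i)"
      using i that(1) by (intro map_of_zip_nth) (auto simp: C_def distinct_map inj_on_def)
    then show ?case
      using i by (simp add: gate_value_eq[OF bc, of x "to_nat (BIn i)"] gate_step_def kind_eq)
        (simp add: C_def)
  next
    case BTop
    then show ?case by (simp add: gate_value_eq[OF bc, of x "to_nat BTop"]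
               gate_step_def kind_eq wires_iff)
  next
    case (BNot a)
    then have "a \<in> S" using closed by fastforce
    then show ?case
      using BNot by (simp add: gate_value_eq[OF bc, of x "to_nat (BNot a)"]
               gate_step_def kind_eq wires_iff)
  next
    case (BAnd a b)
    then have "a \<in> S" "b \<in> S" using closed by fastforce+
    then show ?case
      using BAnd by (auto simp: gate_value_eq[OF bc, of x "to_nat (BAnd a b)"]
               gate_step_def kind_eq wires_iff)
  next
    case (BBuf i a)
    then have "a \<in> S" using closed by fastforce
    then show ?case
      using BBuf by (simp add: gate_value_eq[OF bc, of x "to_nat (BBuf i a)"]
               gate_step_def kind_eq wires_iff)
  qed
  have "circuit_output C x = map (beval x) as" if "length x = n" for x
  proof -
    show ?thesis
      using val[OF that] B_S by (auto simp: circuit_output_def C_def B_def intro!: nth_equalityI)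
  qed
  moreover have "circuit_size C \<le> n + length as + (\<Sum>a\<leftarrow>as. bsize a)"
  proof -
    have "circuit_size C = card S"
      by (simp add: circuit_size_def C_def card_image)
    also have "\<dots> \<le> card (BIn ` {..<n}) + card (\<Union>i<length as. subforms (B i))"
      unfolding S_def by (rule card_Un_le)
    also have "card (BIn ` {..<n}) = n"
      by (simp add: card_image inj_on_def)
    also have "card (\<Union>i<length as. subforms (B i)) \<le> (\<Sum>i<length as. card (subforms (B i)))"
      by (rule card_UN_le) simp
    \<comment> \<open>The successor counts the buffer on top of the formula.\<close>
    also have "\<dots> \<le> (\<Sum>i<length as. Suc (bsize (as ! i)))"
      using card_subforms[of "B _"] by (intro sum_mono) (simp add: B_def)
    also have "\<dots> = length as + (\<Sum>a\<leftarrow>as. bsize a)"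
      by (simp add: sum_Suc sum_list_sum_nth atLeast0LessThan)
    finally show ?thesis by simp
  qed
  ultimately show ?thesis using bc by (intro exI[of _ C]) (simp add: C_def)
qed


section \<open>Compiling schemata and clauses\<close>

text \<open>Lists with repetitions make the linear bound on the number of symbol bits a plain sum of
  lengths.\<close>

primrec props :: "('p, 'v) schema \<Rightarrow> 'p list" where
  "props Top = []"
| "props (Prop p) = [p]"
| "props (SVar Y) = []"
| "props (Neg \<phi>) = props \<phi>"
| "props (Conj \<phi> \<psi>) = props \<phi> @ props \<psi>"
| "props (Dia i \<phi>) = props \<phi>"

lemma length_props: "length (props \<phi>) \<le> schema_size \<phi>"
  by (induction \<phi>) auto

lemma props_subset: "schema_over PS T \<phi> \<Longrightarrow> set (props \<phi>) \<subseteq> PS"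
  by (induction \<phi>) auto

lemma schema_size_pos: "schema_size \<phi> \<ge> 1"
  by (induction \<phi>) auto

fun clause_props :: "('p, 'v) iter_clause \<Rightarrow> 'p list" where
  "clause_props (Standard \<psi>) = props \<psi>"
| "clause_props (Conditional cs \<chi>) =
     concat (map (\<lambda>(\<phi>, \<psi>). props \<phi> @ props \<psi>) cs) @ props \<chi>"

lemma length_clause_props: "length (clause_props c) \<le> iter_clause_size c"
proof (cases c)
  case (Conditional cs \<chi>)
  have "length (concat (map (\<lambda>(\<phi>, \<psi>). props \<phi> @ props \<psi>) cs))
          \<le> (\<Sum>(\<phi>, \<psi>)\<leftarrow>cs. schema_size \<phi> + schema_size \<psi>)"
    by (induction cs) (auto intro!: add_mono length_props)
  then show ?thesis using Conditional length_props[of \<chi>] by simp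
qed (simp add: length_props)

lemma clause_props_subset: "iter_clause_over PS T c \<Longrightarrow> set (clause_props c) \<subseteq> PS"
  by (cases c) (fastforce dest: props_subset)+

text \<open>
  Block \<open>0\<close> of the input belongs to the node itself and block \<open>j \<ge> 1\<close> to its \<open>j\<close>th neighbour;
  \<open>P\<close>, \<open>V\<close> and \<open>F\<close> give the symbols, variables and flag of a block.
\<close>

fun compile :: "nat \<Rightarrow> (nat \<Rightarrow> 'p \<Rightarrow> bform) \<Rightarrow> (nat \<Rightarrow> 'v \<Rightarrow> bform) \<Rightarrow> (nat \<Rightarrow> bform) \<Rightarrow> nat \<Rightarrow>
    ('p, 'v) schema \<Rightarrow> bform" where
  "compile \<Delta> P V F j Top = BTop"
| "compile \<Delta> P V F j (Prop p) = P j p"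
| "compile \<Delta> P V F j (SVar Y) = V j Y"
| "compile \<Delta> P V F j (Neg \<phi>) = BNot (compile \<Delta> P V F j \<phi>)"
| "compile \<Delta> P V F j (Conj \<phi> \<psi>) = BAnd (compile \<Delta> P V F j \<phi>) (compile \<Delta> P V F j \<psi>)"
| "compile \<Delta> P V F j (Dia i \<phi>) =
     (if i \<le> \<Delta> then BAnd (F i) (compile \<Delta> P V F i \<phi>) else BNot BTop)"

text \<open>The factor 2 pays for diamonds: besides its conjunction a diamond reads a flag, and one
  with index beyond \<Delta> becomes the constant \<open>BNot BTop\<close> of size 2.\<close>

lemma bsize_compile:
  assumes "\<And>j p. bsize (P j p) = 1" "\<And>j Y. bsize (V j Y) = 1" "\<And>j. bsize (F j) = 1"
  shows "bsize (compile \<Delta> P V F j \<phi>) \<le> 2 * schema_size \<phi>"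
proof (induction \<phi> arbitrary: j)
  case (Dia i \<phi>)
  show ?case using Dia[of i] schema_size_pos[of \<phi>] assms by auto
next
  case (Neg \<phi>)
  show ?case using Neg[of j] by simp
next
  case (Conj \<phi> \<psi>)
  show ?case using Conj(1)[of j] Conj(2)[of j] by simp
qed (use assms in simp_all)

lemma inputs_compile:
  assumes "schema_over PS T \<phi>" "j \<le> \<Delta>"
    and "\<And>j p. j \<le> \<Delta> \<Longrightarrow> p \<in> set (props \<phi>) \<Longrightarrow> inputs (P j p) \<subseteq> N"
    and "\<And>j Y. j \<le> \<Delta> \<Longrightarrow> Y \<in> T \<Longrightarrow> inputs (V j Y) \<subseteq> N"
    and "\<And>j. j \<le> \<Delta> \<Longrightarrow> inputs (F j) \<subseteq> N"
  shows "inputs (compile \<Delta> P V F j \<phi>) \<subseteq> N"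
  using assms by (induction \<phi> arbitrary: j) simp_all

lemma inputs_compile_depth_0:
  assumes "schema_over PS T \<phi>" "modal_depth \<phi> = 0"
    and "\<And>p. p \<in> set (props \<phi>) \<Longrightarrow> inputs (P j p) \<subseteq> N"
    and "\<And>Y. Y \<in> T \<Longrightarrow> inputs (V j Y) \<subseteq> N"
  shows "inputs (compile \<Delta> P V F j \<phi>) \<subseteq> N"
  using assms by (induction \<phi>) simp_all

text \<open>Without diamonds only block \<open>j\<close> is read, so a single node \<open>v\<close>
  matters: a neighbour for the body of a diamond, or the node itself for a terminal clause.\<close>

lemma beval_compile_depth_0:
  assumes "schema_over PS T \<phi>" "modal_depth \<phi> = 0"
    and "\<And>p. p \<in> set (props \<phi>) \<Longrightarrow> beval x (P j p) \<longleftrightarrow> v \<in> valuation M p"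
    and "\<And>Y. Y \<in> T \<Longrightarrow> beval x (V j Y) \<longleftrightarrow> sat Ids PS M v (\<sigma> Y)"
  shows "beval x (compile \<Delta> P V F j \<phi>) \<longleftrightarrow> sat Ids PS M v (schema_subst \<sigma> \<phi>)"
  using assms by (induction \<phi>) simp_all

text \<open>Seen as its own instance under \<open>SVar\<close>, a terminal clause falls under
  \<open>beval_compile_depth_0\<close>.\<close>

lemma schema_subst_SVar: "schema_subst SVar \<phi> = \<phi>"
  by (induction \<phi>) simp_all

text \<open>The body of a diamond has depth 0, so block \<open>i\<close> determines its value. If
  the neighbour is missing, either its flag is 0 or \<open>i\<close> exceeds \<Delta>, and the
  compiled diamond is false. A nested diamond would wrongly address the blocks of \<open>w\<close>
  again, hence the bound on the depth.\<close>

lemma beval_compile_depth_1: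
  assumes "schema_over PS T \<phi>" "modal_depth \<phi> \<le> 1"
    and "\<And>p. p \<in> set (props \<phi>) \<Longrightarrow> beval x (P 0 p) \<longleftrightarrow> w \<in> valuation M p"
    and "\<And>Y. Y \<in> T \<Longrightarrow> beval x (V 0 Y) \<longleftrightarrow> sat Ids PS M w (\<sigma> Y)"
    and "vs = neighbours Ids PS M w" "length vs \<le> \<Delta>"
    and "\<And>i p. 1 \<le> i \<Longrightarrow> i \<le> length vs \<Longrightarrow> p \<in> set (props \<phi>) \<Longrightarrow>
           beval x (P i p) \<longleftrightarrow> vs ! (i - 1) \<in> valuation M p"
    and "\<And>i Y. 1 \<le> i \<Longrightarrow> i \<le> length vs \<Longrightarrow> Y \<in> T \<Longrightarrow>
           beval x (V i Y) \<longleftrightarrow> sat Ids PS M (vs ! (i - 1)) (\<sigma> Y)"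
    and "\<And>i. 1 \<le> i \<Longrightarrow> i \<le> \<Delta> \<Longrightarrow> beval x (F i) \<longleftrightarrow> i \<le> length vs"
  shows "beval x (compile \<Delta> P V F 0 \<phi>) \<longleftrightarrow> sat Ids PS M w (schema_subst \<sigma> \<phi>)"
  using assms
proof (induction \<phi>)
  case (Dia i \<phi>)
  show ?case
  proof (cases "i \<le> length vs")
    case True
    have "beval x (compile \<Delta> P V F i \<phi>) \<longleftrightarrow> sat Ids PS M (vs ! (i - 1)) (schema_subst \<sigma> \<phi>)"
      using Dia.prems True by (intro beval_compile_depth_0[where T = T and PS = PS]) simp_all
    then show ?thesis using Dia.prems True by simp
  next
    case False
    then show ?thesis using Dia.prems by auto
  qed
qed simp_all

text \<open>The Boolean if-then-else. It duplicates the condition but neither branch, so nesting in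
  the last argument adds sizes instead of doubling them.\<close>

definition bite :: "bform \<Rightarrow> bform \<Rightarrow> bform \<Rightarrow> bform" where
  "bite c a b = BNot (BAnd (BNot (BAnd c a)) (BNot (BAnd (BNot c) b)))"

lemma beval_bite [simp]: "beval x (bite c a b) = (if beval x c then beval x a else beval x b)"
  by (simp add: bite_def)

lemma inputs_bite [simp]: "inputs (bite c a b) = inputs c \<union> inputs a \<union> inputs b"
  by (auto simp: bite_def)

lemma bsize_bite: "bsize (bite c a b) = 2 * bsize c + bsize a + bsize b + 7"
  by (simp add: bite_def)

fun compile_clause :: "(('p, 'v) schema \<Rightarrow> bform) \<Rightarrow> ('p, 'v) iter_clause \<Rightarrow> bform" where
  "compile_clause K (Standard \<psi>) = K \<psi>"
| "compile_clause K (Conditional cs \<chi>) = foldr (\<lambda>(\<phi>, \<psi>). bite (K \<phi>) (K \<psi>)) cs (K \<chi>)"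

text \<open>A pair with condition of size \<open>s\<close> and consequence of size \<open>t\<close>
  adds at most \<open>4 * s + 2 * t + 7\<close>. As \<open>s\<close> is at least 1, the 7 is
  absorbed by \<open>7 * s\<close>, which gives 11.\<close>

lemma bsize_compile_clause:
  assumes "\<And>\<phi>. bsize (K \<phi>) \<le> 2 * schema_size \<phi>"
  shows "bsize (compile_clause K c) \<le> 11 * iter_clause_size c"
proof (cases c)
  case (Standard \<psi>)
  then show ?thesis using assms[of \<psi>] by simp
next
  case (Conditional cs \<chi>)
  have "bsize (foldr (\<lambda>(\<phi>, \<psi>). bite (K \<phi>) (K \<psi>)) cs (K \<chi>))
          \<le> 11 * ((\<Sum>(\<phi>, \<psi>)\<leftarrow>cs. schema_size \<phi> + schema_size \<psi>) + schema_size \<chi>)"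
  proof (induction cs)
    case Nil
    then show ?case using assms[of \<chi>] by simp
  next
    case (Cons a cs)
    obtain \<phi> \<psi> where "a = (\<phi>, \<psi>)" by fastforce
    then show ?case
      using Cons assms[of \<phi>] assms[of \<psi>] schema_size_pos[of \<phi>] by (simp add: bsize_bite)
  qed
  then show ?thesis using Conditional by simp
qed

lemma inputs_compile_clause:
  assumes "iter_clause_over PS T c"
    and "\<And>\<phi>. schema_over PS T \<phi> \<Longrightarrow> modal_depth \<phi> \<le> 1 \<Longrightarrow>
           set (props \<phi>) \<subseteq> set (clause_props c) \<Longrightarrow> inputs (K \<phi>) \<subseteq> N"
  shows "inputs (compile_clause K c) \<subseteq> N"
proof (cases c)
  case (Standard \<psi>)
  then show ?thesis using assms by simp
next
  case (Conditional cs \<chi>)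
  have K: "inputs (K \<phi>) \<subseteq> N \<and> inputs (K \<psi>) \<subseteq> N" if "(\<phi>, \<psi>) \<in> set cs" for \<phi> \<psi>
  proof -
    have "schema_over PS T \<phi>" "modal_depth \<phi> = 0" "schema_over PS T \<psi>" "modal_depth \<psi> \<le> 1"
      using that assms(1) Conditional by auto
    moreover have "set (props \<phi>) \<subseteq> set (clause_props c)" "set (props \<psi>) \<subseteq> set (clause_props c)"
      using that Conditional by auto
    ultimately show ?thesis using assms(2) by simp
  qed
  \<comment> \<open>The list varies in the induction while the clause \<open>c\<close>, to which the
    hypotheses refer, stays fixed.\<close>
  have "inputs (foldr (\<lambda>(\<phi>, \<psi>). bite (K \<phi>) (K \<psi>)) cs' (K \<chi>)) \<subseteq> N" if "set cs' \<subseteq> set cs" for cs'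
    using that
  proof (induction cs')
    case Nil
    then show ?case using assms Conditional by simp
  next
    case (Cons a cs')
    obtain \<phi> \<psi> where a: "a = (\<phi>, \<psi>)" by fastforce
    then show ?case using Cons K[of \<phi> \<psi>] by simp
  qed
  then show ?thesis using Conditional by simp
qed

section \<open>Conditional clauses as decision lists\<close>

lemma sat_subst_big_conj:
  "sat Ids PS M w (schema_subst \<sigma> (big_conj \<phi>s)) \<longleftrightarrow>
     (\<forall>\<phi>\<in>set \<phi>s. sat Ids PS M w (schema_subst \<sigma> \<phi>))"
  by (induction \<phi>s) (auto simp: big_conj_def)

lemma sat_subst_big_disj:
  "sat Ids PS M w (schema_subst \<sigma> (big_disj \<phi>s)) \<longleftrightarrow>
     (\<exists>\<phi>\<in>set \<phi>s. sat Ids PS M w (schema_subst \<sigma> \<phi>))"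
  by (induction \<phi>s) (auto simp: big_disj_def Disj_def)

lemma sat_iter_schema_Nil:
  "sat Ids PS M w (schema_subst \<sigma> (iter_schema (Conditional [] \<chi>))) \<longleftrightarrow>
     sat Ids PS M w (schema_subst \<sigma> \<chi>)"
  by (simp add: Disj_def big_disj_def big_conj_def)

lemma sat_iter_schema_Cons:
  "sat Ids PS M w (schema_subst \<sigma> (iter_schema (Conditional ((\<phi>, \<psi>) # cs) \<chi>))) \<longleftrightarrow>
     (if sat Ids PS M w (schema_subst \<sigma> \<phi>) then sat Ids PS M w (schema_subst \<sigma> \<psi>)
      else sat Ids PS M w (schema_subst \<sigma> (iter_schema (Conditional cs \<chi>))))"
proof -
  define S where "S \<theta> = sat Ids PS M w (schema_subst \<sigma> \<theta>)" for \<theta>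
  have *: "S (iter_schema (Conditional cs \<chi>)) \<longleftrightarrow>
      (\<exists>j<length cs. (\<forall>i<j. \<not> S (fst (cs ! i))) \<and> S (fst (cs ! j)) \<and> S (snd (cs ! j))) \<or>
      (\<forall>j<length cs. \<not> S (fst (cs ! j))) \<and> S \<chi>" for cs
    by (auto simp: S_def Disj_def sat_subst_big_conj sat_subst_big_disj)
  have "S (iter_schema (Conditional ((\<phi>, \<psi>) # cs) \<chi>)) \<longleftrightarrow>
     (if S \<phi> then S \<psi> else S (iter_schema (Conditional cs \<chi>)))"
    unfolding * by (simp add: Ex_less_Suc2 All_less_Suc2)
  then show ?thesis by (simp add: S_def)
qed

text \<open>Both sides obey the same recursion on the list of pairs. \<open>K\<close> is only
  assumed correct for schemata whose symbols occur in the clause, because only such symbols have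
  bits in the blocks.\<close>

lemma beval_compile_clause:
  assumes "iter_clause_over PS T c"
    and K: "\<And>\<phi>. schema_over PS T \<phi> \<Longrightarrow> modal_depth \<phi> \<le> 1 \<Longrightarrow>
           set (props \<phi>) \<subseteq> set (clause_props c) \<Longrightarrow>
           beval x (K \<phi>) \<longleftrightarrow> sat Ids PS M w (schema_subst \<sigma> \<phi>)"
  shows "beval x (compile_clause K c) \<longleftrightarrow> sat Ids PS M w (schema_subst \<sigma> (iter_schema c))"
proof (cases c)
  case (Standard \<psi>)
  then show ?thesis using assms by simp
next
  case (Conditional cs \<chi>)
  have \<chi>: "beval x (K \<chi>) \<longleftrightarrow> sat Ids PS M w (schema_subst \<sigma> \<chi>)"
    using assms Conditional by simp
  have *: "(beval x (K \<phi>) \<longleftrightarrow> sat Ids PS M w (schema_subst \<sigma> \<phi>)) \<and>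
           (beval x (K \<psi>) \<longleftrightarrow> sat Ids PS M w (schema_subst \<sigma> \<psi>))" if "(\<phi>, \<psi>) \<in> set cs" for \<phi> \<psi>
  proof -
    have "schema_over PS T \<phi>" "modal_depth \<phi> = 0" "schema_over PS T \<psi>" "modal_depth \<psi> \<le> 1"
      using that assms(1) Conditional by auto
    moreover have "set (props \<phi>) \<subseteq> set (clause_props c)" "set (props \<psi>) \<subseteq> set (clause_props c)"
      using that Conditional by auto
    ultimately show ?thesis using K by simp
  qed
  have "beval x (foldr (\<lambda>(\<phi>, \<psi>). bite (K \<phi>) (K \<psi>)) cs' (K \<chi>)) \<longleftrightarrow>
        sat Ids PS M w (schema_subst \<sigma> (iter_schema (Conditional cs' \<chi>)))"
    if "set cs' \<subseteq> set cs" for cs'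
    using that
  proof (induction cs')
    case Nil
    then show ?case using \<chi> by (simp add: sat_iter_schema_Nil del: iter_schema.simps)
  next
    case (Cons a cs')
    obtain \<phi> \<psi> where a: "a = (\<phi>, \<psi>)" by fastforce
    then show ?case
      using Cons *[of \<phi> \<psi>] by (simp add: sat_iter_schema_Cons del: iter_schema.simps)
  qed
  then show ?thesis using Conditional by (simp del: iter_schema.simps)
qed


section \<open>The circuit of a program\<close>

definition pos :: "'a list \<Rightarrow> 'a \<Rightarrow> nat" where
  "pos xs x = length (takeWhile (\<lambda>y. y \<noteq> x) xs)"

lemma pos_less: "x \<in> set xs \<Longrightarrow> pos xs x < length xs"
  unfolding pos_def by (induction xs) auto

lemma nth_pos: "x \<in> set xs \<Longrightarrow> xs ! pos xs x = x"
  unfolding pos_def by (induction xs) auto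

lemma nth_concat_blocks:
  assumes "\<And>xs. xs \<in> set xss \<Longrightarrow> length xs = K" "j < length xss" "i < K"
  shows "concat xss ! (j * K + i) = xss ! j ! i"
  using assms
proof (induction xss arbitrary: j)
  case (Cons xs xss)
  then show ?case by (cases j) (simp_all add: nth_append add.assoc)
qed simp

lemma length_concat_blocks:
  assumes "\<And>xs. xs \<in> set xss \<Longrightarrow> length xs = K"
  shows "length (concat xss) = length xss * K"
  using assms by (induction xss) auto

lemma
  assumes "M \<in> id_models Ids PS \<Delta>" "w \<in> worlds M"
  shows set_neighbours: "set (neighbours Ids PS M w) \<subseteq> worlds M"
    and length_neighbours: "length (neighbours Ids PS M w) \<le> \<Delta>"
proof -
  let ?A = "accs M `` {w}"
  have A: "?A \<subseteq> worlds M" and "finite (worlds M)" and inj: "inj_on (ident Ids PS M) (worlds M)"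
    and card: "card ?A \<le> \<Delta>"
    using assms by (auto simp: id_models_def)
  then have "finite ?A" by (auto intro: finite_subset)
  \<comment> \<open>Insertion by key does not depend on the order of insertion when the keys are
    distinct, which the identifiers guarantee; this yields the set and the length of the sorted
    list.\<close>
  interpret folding_insort_key "(\<le>)" "(<)" "worlds M" "ident Ids PS M"
    using inj by unfold_locales
  show "set (neighbours Ids PS M w) \<subseteq> worlds M"
    using A \<open>finite ?A\<close>
    by (simp add: neighbours_def linorder_class.sorted_key_list_of_set_dict)
  show "length (neighbours Ids PS M w) \<le> \<Delta>"
    using A card by (simp add: neighbours_def linorder_class.sorted_key_list_of_set_dict)
qed

section \<open>Layout of inputs and states for a fixed program\<close>

locale nonempty_program =
  fixes PS :: "'p::linorder set" and \<Delta> :: nat and \<Lambda> :: "('p, 'v) program"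
  assumes finite_PS: "finite PS"
    and program: "mpmsc_program PS \<Lambda>"
    and nonempty: "heads \<Lambda> \<noteq> []"
begin

text \<open>The number of transmitted symbols is bounded by the program size, whereas sending all of
  \<open>PS\<close> would cost about \<open>\<Delta> * card PS\<close> input gates.\<close>

definition symbols :: "'p list" where
  "symbols = concat (map (\<lambda>Y. clause_props (iteration \<Lambda> Y)) (heads \<Lambda>))"

definition width :: nat where
  "width = length (heads \<Lambda>) + 1 + length symbols"

definition block :: "nat \<Rightarrow> nat \<Rightarrow> bform" where
  "block j i = BIn (card PS + (j * width + i))"

definition own_symbol :: "'p \<Rightarrow> bform" where
  "own_symbol p = BIn (pos (sorted_list_of_set PS) p)"

text \<open>The node's own symbols come from the local input: in round 0 all blocks are zero, and
  the symbols of a terminal clause may lie outside \<open>symbols\<close>.\<close>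

definition P where
  "P j p = (if j = 0 then own_symbol p else block j (length (heads \<Lambda>) + 1 + pos symbols p))"

definition V where
  "V j Y = block j (pos (heads \<Lambda>) Y)"

definition F where
  "F j = block j (length (heads \<Lambda>))"

definition head_form :: "'v \<Rightarrow> bform" where
  "head_form Y = bite (F 0) (compile_clause (compile \<Delta> P V F 0) (iteration \<Lambda> Y))
                            (compile \<Delta> P V F 0 (terminal \<Lambda> Y))"

definition forms :: "bform list" where
  "forms = map head_form (heads \<Lambda>) @ BTop # map own_symbol symbols"

definition state :: "'p set \<Rightarrow> ('w, 'p) kripke \<Rightarrow> nat \<Rightarrow> 'w \<Rightarrow> bool list" where
  "state Ids M n w =
     configuration Ids PS \<Lambda> M n w @ True # map (\<lambda>p. w \<in> valuation M p) symbols"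

lemma length_forms: "length forms = width"
  by (simp add: forms_def width_def)

lemma length_state: "length (state Ids M n w) = width"
  by (simp add: state_def width_def configuration_def)

lemma symbols_subset: "set symbols \<subseteq> PS"
  using program clause_props_subset
  unfolding symbols_def mpmsc_program_def by fastforce

lemma inputs_block: "j \<le> \<Delta> \<Longrightarrow> i < width \<Longrightarrow> inputs (block j i) \<subseteq> {..<card PS + width * (\<Delta> + 1)}"
proof -
  assume "j \<le> \<Delta>" "i < width"
  then have "j * width + i < \<Delta> * width + width"
    by (intro add_le_less_mono mult_right_mono) auto
  then show ?thesis by (simp add: block_def algebra_simps)
qed

lemma inputs_own_symbol: "p \<in> PS \<Longrightarrow> inputs (own_symbol p) \<subseteq> {..<card PS + n}"
  using pos_less[of p "sorted_list_of_set PS"] finite_PS by (simp add: own_symbol_def)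

lemma inputs_forms:
  assumes "a \<in> set forms"
  shows "inputs a \<subseteq> {..<card PS + width * (\<Delta> + 1)}" (is "_ \<subseteq> ?N")
proof -
  have V: "inputs (V j Y) \<subseteq> ?N" if "j \<le> \<Delta>" "Y \<in> set (heads \<Lambda>)" for j Y
    unfolding V_def using that pos_less[OF that(2)] by (intro inputs_block) (auto simp: width_def)
  have F: "inputs (F j) \<subseteq> ?N" if "j \<le> \<Delta>" for j
    unfolding F_def using that by (intro inputs_block) (auto simp: width_def)
  have P: "inputs (P j p) \<subseteq> ?N" if "j \<le> \<Delta>" "p \<in> set symbols" for j p
  proof (cases "j = 0")
    case True
    then show ?thesis using that symbols_subset inputs_own_symbol by (auto simp: P_def)
  next
    case False
    then show ?thesis using that pos_less[OF that(2)] inputs_block[OF that(1)]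
      by (simp add: P_def width_def)
  qed
  have "inputs (head_form Y) \<subseteq> ?N" if Y: "Y \<in> set (heads \<Lambda>)" for Y
  proof -
    have it: "iter_clause_over PS (set (heads \<Lambda>)) (iteration \<Lambda> Y)"
      and t: "schema_over PS {} (terminal \<Lambda> Y)" "modal_depth (terminal \<Lambda> Y) = 0"
      using program Y by (auto simp: mpmsc_program_def)
    have sym: "set (clause_props (iteration \<Lambda> Y)) \<subseteq> set symbols"
      using Y by (auto simp: symbols_def)
    have "inputs (compile_clause (compile \<Delta> P V F 0) (iteration \<Lambda> Y)) \<subseteq> ?N"
    proof (rule inputs_compile_clause[OF it])
      fix \<phi> :: "('p, 'v) schema"
      assume "schema_over PS (set (heads \<Lambda>)) \<phi>"
        and "set (props \<phi>) \<subseteq> set (clause_props (iteration \<Lambda> Y))"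
      then show "inputs (compile \<Delta> P V F 0 \<phi>) \<subseteq> ?N"
        using P V F sym by (intro inputs_compile) blast+
    qed
    \<comment> \<open>A terminal clause has neither variables nor diamonds, so it reads the local
      input only.\<close>
    moreover have "inputs (compile \<Delta> P V F 0 (terminal \<Lambda> Y)) \<subseteq> ?N"
      using t props_subset[OF t(1)] inputs_own_symbol
      by (intro inputs_compile_depth_0[OF t]) (auto simp: P_def)
    ultimately show ?thesis using F[of 0] by (simp add: head_form_def)
  qed
  moreover have "inputs (own_symbol p) \<subseteq> ?N" if "p \<in> set symbols" for p
    using that symbols_subset inputs_own_symbol by blast
  ultimately show ?thesis using assms by (auto simp: forms_def)
qed

text \<open>The second bound absorbs the flag: with at least one head, the first bound makes the
  program size positive.\<close>

lemma program_size_ge: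
  "length (heads \<Lambda>) + length symbols \<le> program_size \<Lambda>"
  "1 + length (heads \<Lambda>) + length symbols \<le> 2 * program_size \<Lambda>"
proof -
  have "length hs + length (concat (map (\<lambda>Y. clause_props (iteration \<Lambda> Y)) hs)) \<le>
     (\<Sum>Y\<leftarrow>hs. (1 + schema_size (terminal \<Lambda> Y)) + (1 + iter_clause_size (iteration \<Lambda> Y)))" for hs
  proof (induction hs)
    case (Cons Y hs)
    then show ?case using length_clause_props[of "iteration \<Lambda> Y"] by simp
  qed simp
  then show *: "length (heads \<Lambda>) + length symbols \<le> program_size \<Lambda>"
    by (simp add: program_size_def symbols_def)
  then show "1 + length (heads \<Lambda>) + length symbols \<le> 2 * program_size \<Lambda>"
    using nonempty by (cases "heads \<Lambda>") auto
qed

text \<open>The head formulas take 11 program sizes: the 9 units that each selecting if-then-else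
  adds fit into the 22 allotted to the two left-hand sides. The other 2 cover the flag and the
  symbol outputs.\<close>

lemma bsize_forms: "(\<Sum>a\<leftarrow>forms. bsize a) \<le> 13 * program_size \<Lambda>"
proof -
  have compile: "bsize (compile \<Delta> P V F 0 \<phi>) \<le> 2 * schema_size \<phi>" for \<phi>
    by (rule bsize_compile) (simp_all add: P_def V_def F_def own_symbol_def block_def)
  have head: "bsize (head_form Y) \<le>
      11 * ((1 + schema_size (terminal \<Lambda> Y)) + (1 + iter_clause_size (iteration \<Lambda> Y)))" for Y
    using compile[of "terminal \<Lambda> Y"] bsize_compile_clause[of "compile \<Delta> P V F 0" "iteration \<Lambda> Y", OF compile]
    by (simp add: head_form_def bsize_bite F_def block_def)
  have "(\<Sum>Y\<leftarrow>heads \<Lambda>. bsize (head_form Y)) \<le> 11 * program_size \<Lambda>"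
    unfolding program_size_def sum_list_const_mult[symmetric] by (intro sum_list_mono head)
  moreover have "(\<Sum>p\<leftarrow>symbols. bsize (own_symbol p)) = length symbols"
    by (simp add: own_symbol_def sum_list_triv)
  ultimately show ?thesis using program_size_ge by (simp add: forms_def o_def)
qed

section \<open>Values of the formulas, round by round\<close>

lemma beval_own_symbol:
  assumes "p \<in> PS"
  shows "beval (local_input PS M w @ y) (own_symbol p) \<longleftrightarrow> w \<in> valuation M p"
  using assms finite_PS pos_less[of p "sorted_list_of_set PS"] nth_pos[of p "sorted_list_of_set PS"]
  by (simp add: own_symbol_def local_input_def nth_append)

lemma beval_block:
  assumes "\<And>xs. xs \<in> set xss \<Longrightarrow> length xs = width" "j < length xss" "i < width"
  shows "beval (local_input PS M w @ concat xss) (block j i) \<longleftrightarrow> xss ! j ! i"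
  using nth_concat_blocks[OF assms] finite_PS
  by (simp add: block_def local_input_def nth_append)

lemma state_flag: "state Ids M n w ! length (heads \<Lambda>)"
  by (simp add: state_def configuration_def nth_append)

lemma state_head:
  "Y \<in> set (heads \<Lambda>) \<Longrightarrow>
     state Ids M n w ! pos (heads \<Lambda>) Y \<longleftrightarrow> sat Ids PS M w (unfolding_at \<Lambda> n Y)"
  by (simp add: state_def configuration_def nth_append pos_less nth_pos)

lemma state_symbol:
  "p \<in> set symbols \<Longrightarrow>
     state Ids M n w ! (length (heads \<Lambda>) + 1 + pos symbols p) \<longleftrightarrow> w \<in> valuation M p"
  by (simp add: state_def configuration_def nth_append pos_less nth_pos)

text \<open>The flag is constant and the symbol bits depend on the local input alone, so they come
  out right whatever \<open>y\<close> is; only the head formulas remain to be checked.\<close>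

lemma forms_eq_state:
  assumes "\<And>Y. Y \<in> set (heads \<Lambda>) \<Longrightarrow>
             beval (local_input PS M w @ y) (head_form Y) \<longleftrightarrow> sat Ids PS M w (unfolding_at \<Lambda> n Y)"
  shows "map (beval (local_input PS M w @ y)) forms = state Ids M n w"
  using assms
  by (simp add: forms_def state_def configuration_def beval_own_symbol subsetD[OF symbols_subset])

lemma beval_forms_0:
  "map (beval (local_input PS M w @ replicate (width * (\<Delta> + 1)) False)) forms = state Ids M 0 w"
proof (rule forms_eq_state)
  fix Y assume Y: "Y \<in> set (heads \<Lambda>)"
  let ?x = "local_input PS M w @ replicate (width * (\<Delta> + 1)) False"
  have t: "schema_over PS {} (terminal \<Lambda> Y)" "modal_depth (terminal \<Lambda> Y) = 0"
    using program Y by (auto simp: mpmsc_program_def)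
  \<comment> \<open>The node's own flag lies in the zero part of the input, so it selects the
    terminal clause.\<close>
  have "length (heads \<Lambda>) < width * (\<Delta> + 1)" by (simp add: width_def)
  then have "\<not> beval ?x (F 0)"
    using finite_PS by (simp add: F_def block_def local_input_def nth_append del: mult_Suc_right)
  moreover have "beval ?x (compile \<Delta> P V F 0 (terminal \<Lambda> Y)) \<longleftrightarrow>
                 sat Ids PS M w (schema_subst SVar (terminal \<Lambda> Y))"
    using props_subset[OF t(1)]
    by (intro beval_compile_depth_0[OF t]) (simp_all add: P_def beval_own_symbol subsetD)
  ultimately show "beval ?x (head_form Y) \<longleftrightarrow> sat Ids PS M w (unfolding_at \<Lambda> 0 Y)"
    by (simp add: head_form_def schema_subst_SVar)
qed

text \<open>States carry flag 1 in every round, also in round 0, where only the input is zero. So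
  the blocks of existing nodes have flag 1 and the padding blocks flag 0, which selects the
  iteration clause and makes diamonds to missing neighbours false.\<close>

lemma beval_forms_Suc:
  fixes Ids M n w
  defines "vs \<equiv> neighbours Ids PS M w"
  defines "xss \<equiv> state Ids M n w # map (state Ids M n) vs @
                  replicate (\<Delta> - length vs) (replicate width False)"
  assumes len: "length vs \<le> \<Delta>"
  shows "map (beval (local_input PS M w @ concat xss)) forms = state Ids M (Suc n) w"
proof (rule forms_eq_state)
  fix Y assume Y: "Y \<in> set (heads \<Lambda>)"
  let ?x = "local_input PS M w @ concat xss"
  have blk: "beval ?x (block j i) \<longleftrightarrow> xss ! j ! i" if "j \<le> \<Delta>" "i < width" for i j
    using that len by (intro beval_block) (auto simp: xss_def length_state)
  \<comment> \<open>The own block takes index 0, so the block of the \<open>i\<close>th neighbour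
    has index \<open>i\<close>, whereas \<open>vs\<close> is counted from 0.\<close>
  have nb: "xss ! i = state Ids M n (vs ! (i - 1))" if "1 \<le> i" "i \<le> length vs" for i
    using that by (cases i) (simp_all add: xss_def nth_append)
  have absent: "xss ! i = replicate width False" if "length vs < i" "i \<le> \<Delta>" for i
    using that by (cases i) (simp_all add: xss_def nth_append)
  have it: "iter_clause_over PS (set (heads \<Lambda>)) (iteration \<Lambda> Y)"
    using program Y by (auto simp: mpmsc_program_def)
  have sym: "set (clause_props (iteration \<Lambda> Y)) \<subseteq> set symbols"
    using Y by (auto simp: symbols_def)
  have head_w: "pos (heads \<Lambda>) X < width" if "X \<in> set (heads \<Lambda>)" for X
    using pos_less[OF that] by (simp add: width_def)
  have sym_w: "length (heads \<Lambda>) + 1 + pos symbols p < width" if "p \<in> set symbols" for p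
    using pos_less[OF that] by (simp add: width_def)
  have flag_w: "length (heads \<Lambda>) < width"
    by (simp add: width_def)
  have "beval ?x (compile_clause (compile \<Delta> P V F 0) (iteration \<Lambda> Y)) \<longleftrightarrow>
        sat Ids PS M w (schema_subst (unfolding_at \<Lambda> n) (iter_schema (iteration \<Lambda> Y)))"
  proof (rule beval_compile_clause[OF it], rule beval_compile_depth_1)
    fix \<phi> :: "('p, 'v) schema" and p
    assume "set (props \<phi>) \<subseteq> set (clause_props (iteration \<Lambda> Y))" "p \<in> set (props \<phi>)"
    then have p: "p \<in> set symbols" using sym by blast
    then show "beval ?x (P 0 p) \<longleftrightarrow> w \<in> valuation M p"
      using symbols_subset by (auto simp: P_def beval_own_symbol)
    show "beval ?x (P i p) \<longleftrightarrow> vs ! (i - 1) \<in> valuation M p" if "1 \<le> i" "i \<le> length vs" for i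
      using that p len blk[OF _ sym_w[OF p], of i] nb[OF that] state_symbol[OF p]
      by (simp add: P_def)
  next
    fix X assume X: "X \<in> set (heads \<Lambda>)"
    show "beval ?x (V 0 X) \<longleftrightarrow> sat Ids PS M w (unfolding_at \<Lambda> n X)"
      using blk[OF _ head_w[OF X], of 0] state_head[OF X] by (simp add: V_def xss_def)
    show "beval ?x (V i X) \<longleftrightarrow> sat Ids PS M (vs ! (i - 1)) (unfolding_at \<Lambda> n X)"
      if "1 \<le> i" "i \<le> length vs" for i
      using that len blk[OF _ head_w[OF X], of i] nb[OF that] state_head[OF X]
      by (simp add: V_def)
  next
    show "beval ?x (F i) \<longleftrightarrow> i \<le> length vs" if "1 \<le> i" "i \<le> \<Delta>" for i
      using that blk[OF _ flag_w, of i] nb[of i] absent[of i] state_flag flag_w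
      by (cases "i \<le> length vs") (simp_all add: F_def)
  qed (use len in \<open>simp_all add: vs_def\<close>)
  moreover have "beval ?x (F 0)"
    using blk[OF _ flag_w, of 0] state_flag by (simp add: F_def xss_def)
  ultimately show "beval ?x (head_form Y) \<longleftrightarrow> sat Ids PS M w (unfolding_at \<Lambda> (Suc n) Y)"
    by (simp add: head_form_def)
qed

text \<open>Induction on the round for all nodes at once, since the next state uses those of the
  neighbours, which are again worlds of \<open>M\<close>. As \<open>out\<close> speaks only of
  inputs of the right length, the padding must be shown to fill them exactly.\<close>

lemma mpc_state_eq:
  assumes N: "mpc_width N = width"
    and out: "\<And>x. length x = card PS + width * (\<Delta> + 1) \<Longrightarrow>
                circuit_output (circ N) x = map (beval x) forms"
    and M: "M \<in> id_models Ids PS \<Delta>"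
    and "w \<in> worlds M"
  shows "mpc_state Ids PS \<Delta> N M n w = state Ids M n w"
  using \<open>w \<in> worlds M\<close>
proof (induction n arbitrary: w)
  case 0
  have "length (local_input PS M w @ replicate (width * (\<Delta> + 1)) False) =
          card PS + width * (\<Delta> + 1)"
    using finite_PS by (simp add: local_input_def)
  then show ?case by (simp only: mpc_state.simps N out beval_forms_0)
next
  case (Suc n)
  define vs where "vs = neighbours Ids PS M w"
  define xss where "xss = state Ids M n w # map (state Ids M n) vs @
                            replicate (\<Delta> - length vs) (replicate width False)"
  have len: "length vs \<le> \<Delta>" and vs: "set vs \<subseteq> worlds M"
    using set_neighbours[OF M Suc.prems] length_neighbours[OF M Suc.prems] by (auto simp: vs_def)
  have map: "map (mpc_state Ids PS \<Delta> N M n) vs = map (state Ids M n) vs"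
    using vs Suc.IH by auto
  have "length (concat xss) = length xss * width"
    by (rule length_concat_blocks) (auto simp: xss_def length_state)
  then have "length (local_input PS M w @ concat xss) = card PS + width * (\<Delta> + 1)"
    using finite_PS len by (simp add: local_input_def xss_def)
  moreover have "mpc_state Ids PS \<Delta> N M (Suc n) w =
                 circuit_output (circ N) (local_input PS M w @ concat xss)"
    using Suc.IH[OF Suc.prems] map
    by (simp add: Let_def vs_def[symmetric] xss_def N del: map_eq_conv)
  ultimately have "mpc_state Ids PS \<Delta> N M (Suc n) w =
                   map (beval (local_input PS M w @ concat xss)) forms"
    using out by simp
  also have "\<dots> = state Ids M (Suc n) w"
    using beval_forms_Suc[of Ids M w n] len by (simp add: vs_def xss_def)
  finally show ?case .
qed

text \<open>Appointed positions lie among the head bits, so the flag and symbol bits behind them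
  leave no trace.\<close>

lemma appointed_state:
  assumes "A \<union> B \<subseteq> {..<length (heads \<Lambda>)}"
  shows "appointed A B (state Ids M n w) = appointed A B (configuration Ids PS \<Lambda> M n w)"
proof -
  have "{i. i + length (heads \<Lambda>) \<in> A \<union> B} = {}" using assms by fastforce
  then show ?thesis
    unfolding appointed_def state_def nths_append by (simp add: configuration_def)
qed

section \<open>Assembling the circuit and the final size bound\<close>

lemma exists_mpc:
  "\<exists>N. mpc_for PS \<Delta> N \<and>
       mpc_size N \<le> 20 * (max 1 \<Delta> * program_size \<Lambda> + card PS) \<and>
       strongly_equivalent TYPE('w) Ids PS \<Delta> \<Lambda> N"
proof -
  obtain C where C: "boolean_circuit C" "length (in_gates C) = card PS + width * (\<Delta> + 1)"
      "length (out_gates C) = width"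
      "circuit_size C \<le> card PS + width * (\<Delta> + 1) + width + (\<Sum>a\<leftarrow>forms. bsize a)"
      "\<And>x. length x = card PS + width * (\<Delta> + 1) \<Longrightarrow> circuit_output C x = map (beval x) forms"
    using circuit_of_formulas[OF inputs_forms] length_forms by metis
  define N where "N = \<lparr>circ = C, att_bits = head_positions \<Lambda> (att_preds \<Lambda>),
                       print_bits = head_positions \<Lambda> (print_preds \<Lambda>)\<rparr>"
  have width_N: "mpc_width N = width" by (simp add: mpc_width_def N_def C)
  have heads: "head_positions \<Lambda> T \<subseteq> {..<length (heads \<Lambda>)}" for T
    by (auto simp: head_positions_def)
  have "head_positions \<Lambda> T \<subseteq> {..<width}" for T
    by (auto simp: head_positions_def width_def)
  then have "mpc_for PS \<Delta> N"
    unfolding mpc_for_def width_N by (simp add: N_def C)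
  moreover have "mpc_size N \<le> 20 * (max 1 \<Delta> * program_size \<Lambda> + card PS)"
  proof -
    \<comment> \<open>For \<Delta> = 0 the bare product with \<Delta> would vanish although the
      circuit still evaluates the clauses; \<open>D\<close> keeps the term \<open>m\<close>.\<close>
    define m D where "m = program_size \<Lambda>" and "D = max 1 \<Delta>"
    have "width \<le> 2 * m" using program_size_ge(2) by (simp add: width_def m_def)
    moreover have "\<Delta> + 1 \<le> 2 * D" by (simp add: D_def)
    ultimately have "width * (\<Delta> + 1) \<le> (2 * m) * (2 * D)" by (rule mult_mono) auto
    moreover have "m \<le> D * m" by (simp add: D_def)
    moreover have "(2 * m) * (2 * D) = 4 * (D * m)" by simp
    \<comment> \<open>In units of \<open>D * m\<close>: 4 for the input gates of the blocks, 2 for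
      the output buffers and 13 for the formulas, 19 in total.\<close>
    ultimately have "circuit_size C \<le> card PS + 20 * (D * m)"
      using C(4) bsize_forms \<open>width \<le> 2 * m\<close> unfolding m_def[symmetric] by linarith
    then show ?thesis by (simp add: mpc_size_def N_def m_def D_def)
  qed
  moreover have "strongly_equivalent TYPE('w) Ids PS \<Delta> \<Lambda> N"
    unfolding strongly_equivalent_def
  proof (intro allI impI ballI)
    fix M :: "('w, 'p) kripke" and w n
    assume "M \<in> id_models Ids PS \<Delta>" "w \<in> worlds M"
    then have "mpc_state Ids PS \<Delta> N M n w = state Ids M n w"
      using C(5) by (intro mpc_state_eq width_N) (simp_all add: N_def)
    then show "program_appointed Ids PS \<Lambda> M n w = mpc_appointed Ids PS \<Delta> N M n w"
      using heads by (simp add: program_appointed_def mpc_appointed_def N_def appointed_state)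
  qed
  ultimately show ?thesis by blast
qed

end

text \<open>
  Without head predicates the program has size 0 and the bound leaves no room for a flag (whose
  blocks would need \<open>\<Delta> + 1\<close> input gates), so the circuit has width 0.
\<close>

lemma exists_mpc_no_heads:
  assumes "heads \<Lambda> = []"
  shows "\<exists>N. mpc_for PS \<Delta> N \<and> mpc_size N \<le> card PS \<and>
             strongly_equivalent TYPE('w) Ids PS \<Delta> \<Lambda> N"
proof -
  \<comment> \<open>The empty list of formulas yields a circuit consisting of input gates
    only.\<close>
  obtain C where C: "boolean_circuit C" "length (in_gates C) = card PS" "out_gates C = []"
      "circuit_size C \<le> card PS"
    using circuit_of_formulas[of "[]" "card PS"] by auto
  define N where "N = \<lparr>circ = C, att_bits = {}, print_bits = {}\<rparr>"
  have "mpc_for PS \<Delta> N" by (simp add: mpc_for_def mpc_width_def N_def C)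
  \<comment> \<open>With no heads and no appointed bits, both appointed strings are empty in every
    round.\<close>
  moreover have "strongly_equivalent TYPE('w) Ids PS \<Delta> \<Lambda> N"
    using assms by (simp add: strongly_equivalent_def program_appointed_def mpc_appointed_def
        appointed_def configuration_def N_def)
  ultimately show ?thesis using C(4) by (intro exI[of _ N]) (simp add: mpc_size_def N_def)
qed

theorem theorem2:
  "\<exists>c::nat. \<forall>(Ids :: 'p::{linorder, countable, infinite} set) (PS :: 'p set) (\<Delta>::nat)
       (\<Lambda> :: ('p, 'v) program).
     finite PS \<and> mpmsc_program PS \<Lambda> \<longrightarrow>
     (\<exists>N. mpc_for PS \<Delta> N \<and>
          mpc_size N \<le> c * (max 1 \<Delta> * program_size \<Lambda> + card PS) \<and>
          strongly_equivalent TYPE('w) Ids PS \<Delta> \<Lambda> N)"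
proof (intro exI[of _ 20] allI impI)
  fix Ids PS :: "'p set" and \<Delta> and \<Lambda> :: "('p, 'v) program"
  assume *: "finite PS \<and> mpmsc_program PS \<Lambda>"
  show "\<exists>N. mpc_for PS \<Delta> N \<and> mpc_size N \<le> 20 * (max 1 \<Delta> * program_size \<Lambda> + card PS) \<and>
            strongly_equivalent TYPE('w) Ids PS \<Delta> \<Lambda> N"
  proof (cases "heads \<Lambda> = []")
    case True
    then obtain N where "mpc_for PS \<Delta> N" "mpc_size N \<le> card PS"
        "strongly_equivalent TYPE('w) Ids PS \<Delta> \<Lambda> N"
      using exists_mpc_no_heads by blast
    then show ?thesis by (intro exI[of _ N]) simp
  next
    case False
    then interpret nonempty_program PS \<Delta> \<Lambda>
      using * by unfold_locales auto
    show ?thesis by (rule exists_mpc)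
  qed
qed

end
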